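(* Let $K$ be a unital commutative ring, let $R$ be a unital $K$-algebra, and let $f\in K\langle\mathcal X\rangle$ be a multilinear polynomial. Suppose that $R$ is generated by its commutators as an ideal and that $R=(f(R)^n)^+$, where $n>1$ is a positive integer. Then there exists $N\in\mathbb N$ such that every $x\in R$ can be written as $x=a_1+\cdots+a_N$ for some $a_i\in f(R)^{[n]}$.
   Context: Algebras are associative. $K\langle\mathcal X\rangle$ is the free associative $K$-algebra on noncommuting variables $x_1,x_2,\dots$. A multilinear polynomial is one of the form $f=\sum_{\sigma\in \mathrm{Sym}(m)}\lambda_\sigma x_{\sigma(1)}\cdots x_{\sigma(m)}$ with $m\ge1$ and $\lambda_\sigma\in K$. $f(R)=\{f(a_1,\dots,a_m)\mid a_i\in R\}$. $f(R)^{[n]}=\{y_1y_2\cdots y_n\mid y_i\in f(R)\}$ is the set of all products of $n$ elements of $f(R)$, and $(f(R)^n)^+$ is the additive subgroup of $R$ generated by $f(R)^{[n]}$. A commutator is an element $[a,b]=ab-ba$ with $a,b\in R$; $R$ is generated by its commutators as an ideal if the two-sided ideal generated by all commutators equals $R$. *)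

theory Defs
  imports "HOL-Algebra.Algebra" "HOL-Combinatorics.Permutations"
begin

text \<open>Unital associative, not necessarily commutative algebras; the locale \<open>algebra\<close> of
  \<open>HOL-Algebra\<close> requires the algebra itself to be commutative.\<close>

locale assoc_algebra = module K R + ring R
  for K (structure) and R (structure) +
  assumes smult_mult_left:
      "\<lbrakk>k \<in> carrier K; x \<in> carrier R; y \<in> carrier R\<rbrakk>
        \<Longrightarrow> (k \<odot>\<^bsub>R\<^esub> x) \<otimes>\<^bsub>R\<^esub> y = k \<odot>\<^bsub>R\<^esub> (x \<otimes>\<^bsub>R\<^esub> y)"
    and smult_mult_right:
      "\<lbrakk>k \<in> carrier K; x \<in> carrier R; y \<in> carrier R\<rbrakk>
        \<Longrightarrow> x \<otimes>\<^bsub>R\<^esub> (k \<odot>\<^bsub>R\<^esub> y) = k \<odot>\<^bsub>R\<^esub> (x \<otimes>\<^bsub>R\<^esub> y)"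

text \<open>The finite product of a list is taken in the order of the list.\<close>

definition list_mult :: "('a, 'm) monoid_scheme \<Rightarrow> 'a list \<Rightarrow> 'a" where
  "list_mult G xs = foldr (\<lambda>x y. x \<otimes>\<^bsub>G\<^esub> y) xs \<one>\<^bsub>G\<^esub>"

text \<open>A word \<open>[i\<^sub>1, \<dots>, i\<^sub>k]\<close> stands for the monomial in the noncommuting variables with indices
  \<open>i\<^sub>1, \<dots>, i\<^sub>k \<ge> 1\<close>. The monomials are a basis of the free algebra, whose elements are therefore
  given by their coefficient functions.\<close>

definition free_algebra_elements :: "('k, 'm) ring_scheme \<Rightarrow> (nat list \<Rightarrow> 'k) set" where
  "free_algebra_elements K =
     {f. (\<forall>w. f w \<in> carrier K) \<and> finite {w. f w \<noteq> \<zero>\<^bsub>K\<^esub>} \<and> {w. f w \<noteq> \<zero>\<^bsub>K\<^esub>} \<subseteq> lists {1..}}"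

definition word_monomial :: "('k, 'm) ring_scheme \<Rightarrow> nat list \<Rightarrow> (nat list \<Rightarrow> 'k)" where
  "word_monomial K w = (\<lambda>v. if v = w then \<one>\<^bsub>K\<^esub> else \<zero>\<^bsub>K\<^esub>)"

definition multilinear ::
  "('k, 'm) ring_scheme \<Rightarrow> (nat list \<Rightarrow> 'k) \<Rightarrow> bool" where
  "multilinear K f \<longleftrightarrow>
     (\<exists>m\<ge>1. \<exists>c \<in> {\<sigma>. \<sigma> permutes {1..m}} \<rightarrow> carrier K.
        f = (\<lambda>v. \<Oplus>\<^bsub>K\<^esub>\<sigma>\<in>{\<sigma>. \<sigma> permutes {1..m}}.
                    c \<sigma> \<otimes>\<^bsub>K\<^esub> word_monomial K (map \<sigma> [1..<Suc m]) v))"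

definition eval_nc ::
  "('k, 'm) ring_scheme \<Rightarrow> ('k, 'r, 'n) module_scheme \<Rightarrow> (nat list \<Rightarrow> 'k) \<Rightarrow> (nat \<Rightarrow> 'r) \<Rightarrow> 'r" where
  "eval_nc K R f a =
     (\<Oplus>\<^bsub>R\<^esub>w\<in>{w. f w \<noteq> \<zero>\<^bsub>K\<^esub>}. f w \<odot>\<^bsub>R\<^esub> list_mult R (map a w))"

text \<open>Valuing all variables at once gives the same set as valuing only those that occur in \<open>f\<close>.\<close>

definition image_nc ::
  "('k, 'm) ring_scheme \<Rightarrow> ('k, 'r, 'n) module_scheme \<Rightarrow> (nat list \<Rightarrow> 'k) \<Rightarrow> 'r set" where
  "image_nc K R f = eval_nc K R f ` (UNIV \<rightarrow> carrier R)"

definition n_products :: "('a, 'm) monoid_scheme \<Rightarrow> nat \<Rightarrow> 'a set \<Rightarrow> 'a set" where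
  "n_products G n S = {list_mult G ys | ys. length ys = n \<and> set ys \<subseteq> S}"

definition additive_span :: "('a, 'm) ring_scheme \<Rightarrow> 'a set \<Rightarrow> 'a set" where
  "additive_span R S = generate (add_monoid R) S"

definition commutators :: "('a, 'm) ring_scheme \<Rightarrow> 'a set" where
  "commutators R =
     {(a \<otimes>\<^bsub>R\<^esub> b) \<ominus>\<^bsub>R\<^esub> (b \<otimes>\<^bsub>R\<^esub> a) | a b. a \<in> carrier R \<and> b \<in> carrier R}"

end

theory Submission
  imports Defs
begin

text \<open>
  Let \<open>S = f(R)\<close> and \<open>P = f(R)\<^bsup>[n]\<^esup>\<close>, and call a subset of \<open>R\<close> bounded if all its elements are sums of \<open>N\<close>
  elements of \<open>P\<close> for a common \<open>N\<close>. Multilinearity gives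
  \<open>[f(a\<^sub>1, \<dots>, a\<^sub>m), r] = \<Sum>\<^sub>i f(a\<^sub>1, \<dots>, [a\<^sub>i, r], \<dots>, a\<^sub>m)\<close>, so \<open>[B, R]\<close> is bounded whenever \<open>B\<close> is, and
  \<open>[x, R]\<close> is bounded for every \<open>x\<close>. Since \<open>b a r = [b, a r] + a r b\<close>, the set \<open>I\<close> of all \<open>a\<close> with \<open>a R\<close>
  bounded is a two-sided ideal. For \<open>a\<close> a product of \<open>n - 1\<close> elements of \<open>S\<close> and \<open>y \<in> S\<close>, the
  identity \<open>[a, y] r = a [y, r] - [y, a r]\<close> shows \<open>[a, y] \<in> I\<close>. As \<open>S\<close> generates \<open>R\<close>, products of
  \<open>n - 1\<close> elements of \<open>S\<close> are central modulo \<open>I\<close>, hence so are products of \<open>(n - 1) n\<close> elements, and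
  these span \<open>R\<close>. So \<open>R / I\<close> is commutative, \<open>I\<close> contains all commutators, \<open>I = R\<close>, and
  \<open>R = 1 R\<close> is bounded.
\<close>

subsection \<open>Sums of boundedly many elements\<close>

text \<open>Sums have exactly \<open>N\<close> summands, not at most \<open>N\<close>; once
  \<open>U\<close> contains zero these sets increase with \<open>N\<close>. The recursion suits
  inductions on \<open>N\<close>, and \<open>nsums_eq_finsum\<close> translates it into indexed
  sums.\<close>

primrec nsums :: "('a, 'm) ring_scheme \<Rightarrow> 'a set \<Rightarrow> nat \<Rightarrow> 'a set" where
  "nsums R U 0 = {\<zero>\<^bsub>R\<^esub>}"
| "nsums R U (Suc N) = {x \<oplus>\<^bsub>R\<^esub> y | x y. x \<in> nsums R U N \<and> y \<in> U}"

lemma (in ring) nsums_closed: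
  assumes "U \<subseteq> carrier R" shows "nsums R U N \<subseteq> carrier R"
  using assms by (induction N) auto

lemma (in ring) nsums_add:
  assumes "U \<subseteq> carrier R" "x \<in> nsums R U M" "y \<in> nsums R U N"
  shows "x \<oplus> y \<in> nsums R U (M + N)"
  using assms(3)
proof (induction N arbitrary: y)
  case 0
  then show ?case using assms nsums_closed[of U M] by auto
next
  case (Suc N)
  then obtain u v where uv: "y = u \<oplus> v" "u \<in> nsums R U N" "v \<in> U" by auto
  moreover have "x \<oplus> y = (x \<oplus> u) \<oplus> v"
    using uv assms nsums_closed[of U M] nsums_closed[of U N] by (simp add: a_assoc subset_iff)
  ultimately show ?case using Suc.IH[OF uv(2)] by auto
qed

lemma (in ring) nsums_incl:
  assumes "U \<subseteq> carrier R" "x \<in> U" shows "x \<in> nsums R U 1"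
  using assms by force

lemma (in ring) nsums_subset_Suc:
  assumes "U \<subseteq> carrier R" "\<zero> \<in> U" shows "nsums R U N \<subseteq> nsums R U (Suc N)"
proof
  fix x assume x: "x \<in> nsums R U N"
  then have "x = x \<oplus> \<zero>" using nsums_closed[OF assms(1), of N] by auto
  then show "x \<in> nsums R U (Suc N)" using x assms(2) by auto
qed

text \<open>Additivity splits the image into \<open>N\<close> pieces, each with \<open>M\<close>
  summands. This transports bounds along negation, multiplication by a fixed element and commutation
  with a fixed element.\<close>

lemma (in ring) nsums_image:
  assumes "U \<subseteq> carrier R" "Y \<subseteq> carrier R"
    and "h \<zero> = \<zero>"
    and "\<And>x y. x \<in> carrier R \<Longrightarrow> y \<in> carrier R \<Longrightarrow> h (x \<oplus> y) = h x \<oplus> h y"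
    and "\<And>x. x \<in> U \<Longrightarrow> h x \<in> nsums R Y M"
    and "x \<in> nsums R U N"
  shows "h x \<in> nsums R Y (N * M)"
  using assms(6)
proof (induction N arbitrary: x)
  case 0
  then show ?case using assms by simp
next
  case (Suc N)
  then obtain u v where uv: "x = u \<oplus> v" "u \<in> nsums R U N" "v \<in> U" by auto
  then have "h x = h u \<oplus> h v" using assms nsums_closed[of U N] by blast
  moreover have "h u \<oplus> h v \<in> nsums R Y (N * M + M)"
    using nsums_add[OF assms(2) Suc.IH[OF uv(2)] assms(5)[OF uv(3)]] .
  ultimately show ?case by (simp add: add.commute)
qed

lemma (in ring) nsums_eq_finsum:
  assumes "U \<subseteq> carrier R"
  shows "nsums R U N = {\<Oplus>i\<in>{1..N}. a i | a. a \<in> {1..N} \<rightarrow> U}"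
proof (induction N)
  case (Suc N)
  have ins: "{1..Suc N} = insert (Suc N) {1..N}" by auto
  have step: "(\<Oplus>i\<in>{1..Suc N}. a i) = (\<Oplus>i\<in>{1..N}. a i) \<oplus> a (Suc N)"
    if "a \<in> {1..Suc N} \<rightarrow> U" for a
  proof -
    have a: "a \<in> {1..N} \<rightarrow> carrier R" "a (Suc N) \<in> carrier R"
      using that assms by (auto simp: Pi_iff)
    then show ?thesis unfolding ins by (simp add: a_comm)
  qed
  show ?case
  proof (intro Set.set_eqI iffI)
    fix x assume "x \<in> nsums R U (Suc N)"
    then obtain a y where a: "x = (\<Oplus>i\<in>{1..N}. a i) \<oplus> y" "a \<in> {1..N} \<rightarrow> U" "y \<in> U"
      unfolding nsums.simps Suc.IH by blast
    define b where "b = a(Suc N := y)"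
    have b: "b \<in> {1..Suc N} \<rightarrow> U" using a by (auto simp: b_def Pi_iff)
    have "(\<Oplus>i\<in>{1..N}. a i) = (\<Oplus>i\<in>{1..N}. b i)"
      by (rule finsum_cong') (use a(2) assms in \<open>auto simp: Pi_iff b_def\<close>)
    then have "x = (\<Oplus>i\<in>{1..Suc N}. b i)"
      using a step[OF b] by (simp add: b_def)
    then show "x \<in> {\<Oplus>i\<in>{1..Suc N}. a i | a. a \<in> {1..Suc N} \<rightarrow> U}" using b by blast
  next
    fix x assume "x \<in> {\<Oplus>i\<in>{1..Suc N}. a i | a. a \<in> {1..Suc N} \<rightarrow> U}"
    then obtain a where a: "x = (\<Oplus>i\<in>{1..Suc N}. a i)" "a \<in> {1..Suc N} \<rightarrow> U" by blast
    then have "x = (\<Oplus>i\<in>{1..N}. a i) \<oplus> a (Suc N)" "a \<in> {1..N} \<rightarrow> U" "a (Suc N) \<in> U"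
      using step[OF a(2)] by (auto simp: Pi_iff)
    then show "x \<in> nsums R U (Suc N)" unfolding nsums.simps Suc.IH by blast
  qed
qed simp

text \<open>As \<open>U\<close> is closed under negation, the inverses that \<open>generate\<close>
  admits are again elements of \<open>U\<close>, so plain sums suffice.\<close>

lemma (in ring) additive_span_eq_nsums:
  assumes "U \<subseteq> carrier R" "\<And>x. x \<in> U \<Longrightarrow> \<ominus> x \<in> U"
  shows "additive_span R U = (\<Union>N. nsums R U N)"
proof
  show "additive_span R U \<subseteq> (\<Union>N. nsums R U N)"
  proof
    fix x assume "x \<in> additive_span R U"
    then show "x \<in> (\<Union>N. nsums R U N)"
      unfolding additive_span_def
    proof (induction rule: generate.induct)
      case one
      then show ?case using nsums.simps(1)[of R U] by (metis UN_iff UNIV_I insertI1 monoid.select_convs(2))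
    next
      case (incl h)
      then show ?case using nsums_incl[OF assms(1)] by blast
    next
      case (inv h)
      then show ?case
        using nsums_incl[OF assms(1) assms(2)] unfolding a_inv_def by blast
    next
      case (eng g h)
      then show ?case using nsums_add[OF assms(1)] by (auto, blast)
    qed
  qed
  have "x \<in> additive_span R U" if "x \<in> nsums R U N" for x N
    using that
  proof (induction N arbitrary: x)
    case 0
    then show ?case using generate.one[of "add_monoid R" U] by (simp add: additive_span_def)
  next
    case (Suc N)
    then obtain u v where "x = u \<oplus> v" "u \<in> additive_span R U" "v \<in> U" by auto
    then show ?case
      using generate.eng[of u "add_monoid R" U v] generate.incl[of v U "add_monoid R"]
      by (simp add: additive_span_def)
  qed
  then show "(\<Union>N. nsums R U N) \<subseteq> additive_span R U" by blast
qed

text \<open>A single \<open>N\<close> has to serve all of \<open>A\<close>. Additive generation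
  alone only gives each element an \<open>N\<close> of its own.\<close>

definition bounded_sums :: "('a, 'm) ring_scheme \<Rightarrow> 'a set \<Rightarrow> 'a set \<Rightarrow> bool" where
  "bounded_sums R U A \<longleftrightarrow> (\<exists>N. A \<subseteq> nsums R U N)"

lemma bounded_sums_subset:
  "bounded_sums R U B \<Longrightarrow> A \<subseteq> B \<Longrightarrow> bounded_sums R U A"
  unfolding bounded_sums_def by blast

lemma (in ring) bounded_sums_add:
  assumes "U \<subseteq> carrier R" "bounded_sums R U A" "bounded_sums R U B"
  shows "bounded_sums R U {a \<oplus> b | a b. a \<in> A \<and> b \<in> B}"
proof -
  obtain M N where "A \<subseteq> nsums R U M" "B \<subseteq> nsums R U N"
    using assms unfolding bounded_sums_def by blast
  then have "{a \<oplus> b | a b. a \<in> A \<and> b \<in> B} \<subseteq> nsums R U (M + N)"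
    using nsums_add[OF assms(1)] by blast
  then show ?thesis unfolding bounded_sums_def by blast
qed

lemma (in ring) bounded_sums_minus:
  assumes "U \<subseteq> carrier R" "\<And>x. x \<in> U \<Longrightarrow> \<ominus> x \<in> U" "bounded_sums R U A"
  shows "bounded_sums R U (a_inv R ` A)"
proof -
  obtain M where M: "A \<subseteq> nsums R U M" using assms unfolding bounded_sums_def by blast
  have "a_inv R ` A \<subseteq> nsums R U (M * 1)"
  proof
    fix y assume "y \<in> a_inv R ` A"
    then obtain x where "y = \<ominus> x" "x \<in> nsums R U M" using M by blast
    moreover have "\<ominus> x \<in> nsums R U (M * 1)"
      by (rule nsums_image[OF assms(1) assms(1) _ _ _ \<open>x \<in> nsums R U M\<close>])
        (use assms(2) nsums_incl[OF assms(1)] in \<open>auto simp: minus_add a_comm\<close>)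
    ultimately show "y \<in> nsums R U (M * 1)" by simp
  qed
  then show ?thesis unfolding bounded_sums_def by blast
qed

subsection \<open>Products\<close>

lemma list_mult_simps [simp]:
  "list_mult G [] = \<one>\<^bsub>G\<^esub>" "list_mult G (x # xs) = x \<otimes>\<^bsub>G\<^esub> list_mult G xs"
  by (simp_all add: list_mult_def)

lemma (in ring) list_mult_closed:
  "set xs \<subseteq> carrier R \<Longrightarrow> list_mult R xs \<in> carrier R"
  by (induction xs) auto

lemma (in ring) list_mult_append:
  "set xs \<subseteq> carrier R \<Longrightarrow> set ys \<subseteq> carrier R \<Longrightarrow>
    list_mult R (xs @ ys) = list_mult R xs \<otimes> list_mult R ys"
  by (induction xs) (auto simp: m_assoc list_mult_closed)

lemma (in ring) n_products_closed:
  "S \<subseteq> carrier R \<Longrightarrow> n_products R k S \<subseteq> carrier R"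
  using list_mult_closed by (fastforce simp: n_products_def)

lemma (in ring) n_products_mult:
  assumes "S \<subseteq> carrier R" "x \<in> n_products R j S" "y \<in> n_products R k S"
  shows "x \<otimes> y \<in> n_products R (j + k) S"
proof -
  obtain xs ys where xs: "x = list_mult R xs" "length xs = j" "set xs \<subseteq> S"
    and ys: "y = list_mult R ys" "length ys = k" "set ys \<subseteq> S"
    using assms unfolding n_products_def by blast
  then have "x \<otimes> y = list_mult R (xs @ ys)" using list_mult_append assms(1) by auto
  then show ?thesis using xs ys unfolding n_products_def by fastforce
qed

lemma (in ring) n_products_1:
  assumes "S \<subseteq> carrier R" "x \<in> S" shows "x \<in> n_products R 1 S"
  unfolding n_products_def using assms by (auto intro!: exI[of _ "[x]"])

lemma (in ring) n_products_split:
  assumes "S \<subseteq> carrier R" "x \<in> n_products R (j + k) S"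
  obtains y z where "x = y \<otimes> z" "y \<in> n_products R j S" "z \<in> n_products R k S"
proof -
  obtain xs where xs: "x = list_mult R xs" "length xs = j + k" "set xs \<subseteq> S"
    using assms unfolding n_products_def by blast
  have s: "set (take j xs) \<subseteq> S" "set (drop j xs) \<subseteq> S"
    using xs(3) set_take_subset set_drop_subset by fast+
  have "x = list_mult R (take j xs) \<otimes> list_mult R (drop j xs)"
    using list_mult_append[of "take j xs" "drop j xs"] s assms(1) xs(1) by auto
  moreover have "list_mult R (take j xs) \<in> n_products R j S"
    "list_mult R (drop j xs) \<in> n_products R k S"
    using s xs(2) unfolding n_products_def by auto
  ultimately show thesis using that by blast
qed

text \<open>Preimages of a subgroup under multiplication by a fixed element, from either side, are
  subgroups. So a long product can be handled by splitting off a block of \<open>n\<close> factors,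
  freeing first the rest and then the block.\<close>

lemma (in ring) subgroup_generated_by_n_products_mult:
  assumes S: "S \<subseteq> carrier R" and span: "carrier R = additive_span R (n_products R n S)"
    and H: "subgroup H (add_monoid R)" and sub: "n_products R (Suc k * n) S \<subseteq> H"
  shows "H = carrier R"
  using H sub
proof (induction k arbitrary: H)
  case 0
  have "additive_span R (n_products R n S) \<subseteq> H"
    unfolding additive_span_def using add.generate_subgroup_incl 0 by simp
  then show ?case using span subgroup.subset[OF \<open>subgroup H (add_monoid R)\<close>] by auto
next
  case (Suc k)
  interpret H: additive_subgroup H R using Suc by (simp add: additive_subgroup.intro)
  \<comment> \<open>The set of these \<open>r\<close> is a subgroup containing all products of
    \<open>Suc k * n\<close> elements, so the induction hypothesis applies to it in place of
    \<open>H\<close>.\<close>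
  have left: "{r \<in> carrier R. r \<otimes> w \<in> H} = carrier R" if w: "w \<in> n_products R n S" for w
  proof (rule Suc.IH)
    have wR: "w \<in> carrier R" using w n_products_closed[OF S] by blast
    show "subgroup {r \<in> carrier R. r \<otimes> w \<in> H} (add_monoid R)"
      by (rule add.subgroupI)
        (use wR H.a_closed H.a_inv_closed H.zero_closed in \<open>auto simp: l_distr l_minus a_inv_def[symmetric] intro!: exI[of _ \<zero>]\<close>)
    show "n_products R (Suc k * n) S \<subseteq> {r \<in> carrier R. r \<otimes> w \<in> H}"
      using n_products_closed[OF S] n_products_mult[OF S _ w, of _ "Suc k * n"] Suc.prems
      by (auto simp: ac_simps subset_iff)
  qed
  have "r \<in> H" if r: "r \<in> carrier R" for r
  proof -
    have "subgroup {w \<in> carrier R. r \<otimes> w \<in> H} (add_monoid R)"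
      by (rule add.subgroupI)
        (use r H.a_closed H.a_inv_closed H.zero_closed in \<open>auto simp: r_distr r_minus a_inv_def[symmetric] intro!: exI[of _ \<zero>]\<close>)
    moreover have "n_products R n S \<subseteq> {w \<in> carrier R. r \<otimes> w \<in> H}"
      using left r n_products_closed[OF S] by blast
    ultimately have "additive_span R (n_products R n S) \<subseteq> {w \<in> carrier R. r \<otimes> w \<in> H}"
      unfolding additive_span_def by (simp add: add.generate_subgroup_incl)
    \<comment> \<open>Now the right factor \<open>w\<close> is arbitrary, and \<open>w = 1\<close>
      leaves \<open>r\<close> itself in \<open>H\<close>.\<close>
    then have "\<one> \<in> {w \<in> carrier R. r \<otimes> w \<in> H}" using span by auto
    then show ?thesis using r by simp
  qed
  then show ?case using H.a_subset by blast
qed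

subsection \<open>The ideal of elements with bounded right multiples\<close>

definition commutator :: "('a, 'm) ring_scheme \<Rightarrow> 'a \<Rightarrow> 'a \<Rightarrow> 'a" where
  "commutator R x y = (x \<otimes>\<^bsub>R\<^esub> y) \<ominus>\<^bsub>R\<^esub> (y \<otimes>\<^bsub>R\<^esub> x)"

section \<open>Commutation with a fixed element as a derivation\<close>

lemma (in ring) commutator_closed [simp]:
  "x \<in> carrier R \<Longrightarrow> y \<in> carrier R \<Longrightarrow> commutator R x y \<in> carrier R"
  by (simp add: commutator_def)

lemma (in ring) commutator_zero_left [simp]: "r \<in> carrier R \<Longrightarrow> commutator R \<zero> r = \<zero>"
  by (simp add: commutator_def)

lemma (in ring) commutator_add_left:
  "\<lbrakk>x \<in> carrier R; y \<in> carrier R; r \<in> carrier R\<rbrakk> \<Longrightarrow>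
    commutator R (x \<oplus> y) r = commutator R x r \<oplus> commutator R y r"
  unfolding commutator_def by algebra

lemma (in ring) commutator_mult_left:
  "\<lbrakk>x \<in> carrier R; y \<in> carrier R; r \<in> carrier R\<rbrakk> \<Longrightarrow>
    commutator R (x \<otimes> y) r = x \<otimes> commutator R y r \<oplus> commutator R x r \<otimes> y"
  unfolding commutator_def by algebra

lemma (in ring) commutator_minus_left:
  "\<lbrakk>x \<in> carrier R; r \<in> carrier R\<rbrakk> \<Longrightarrow> commutator R (\<ominus> x) r = \<ominus> commutator R x r"
  unfolding commutator_def by algebra

lemma (in ring) commutator_swap:
  "\<lbrakk>x \<in> carrier R; r \<in> carrier R\<rbrakk> \<Longrightarrow> commutator R r x = \<ominus> commutator R x r"
  unfolding commutator_def by algebra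

text \<open>This is the centralizer of \<open>B\<close> modulo \<open>I\<close>. Closure under
  products is the Leibniz rule \<open>commutator_mult_left\<close> together with the two-sidedness
  of \<open>I\<close>.\<close>

lemma (in ring) subring_commuting_mod_ideal:
  assumes I: "ideal I R" and B: "B \<subseteq> carrier R"
  shows "subgroup {x \<in> carrier R. \<forall>b\<in>B. commutator R x b \<in> I} (add_monoid R)"
    and "x \<in> carrier R \<Longrightarrow> y \<in> carrier R \<Longrightarrow> \<forall>b\<in>B. commutator R x b \<in> I \<Longrightarrow>
      \<forall>b\<in>B. commutator R y b \<in> I \<Longrightarrow> \<forall>b\<in>B. commutator R (x \<otimes> y) b \<in> I"
proof -
  interpret I: ideal I R by (rule I)
  show "subgroup {x \<in> carrier R. \<forall>b\<in>B. commutator R x b \<in> I} (add_monoid R)"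
    by (rule add.subgroupI)
      (use B in \<open>auto simp: commutator_add_left commutator_minus_left a_inv_def[symmetric] subset_iff
        intro!: exI[of _ \<zero>]\<close>)
  show "\<forall>b\<in>B. commutator R (x \<otimes> y) b \<in> I"
    if "x \<in> carrier R" "y \<in> carrier R" "\<forall>b\<in>B. commutator R x b \<in> I"
      "\<forall>b\<in>B. commutator R y b \<in> I"
    using that B I.I_l_closed I.I_r_closed
    by (auto simp: commutator_mult_left subset_iff)
qed

text \<open>These are the only properties of the value set of \<open>f\<close> that the boundedness
  argument uses. The number \<open>m\<close> does not depend on \<open>x\<close> or
  \<open>r\<close>; for a multilinear polynomial it is the degree.\<close>

locale spanning_products = ring R for R (structure) +
  fixes S :: "'a set" and m n :: nat
  assumes S_closed: "S \<subseteq> carrier R"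
    and zero_S: "\<zero> \<in> S"
    and minus_S: "x \<in> S \<Longrightarrow> \<ominus> x \<in> S"
    and commutator_S: "x \<in> S \<Longrightarrow> r \<in> carrier R \<Longrightarrow> commutator R x r \<in> nsums R S m"
    and n_gt_1: "n > 1"
    and span: "carrier R = additive_span R (n_products R n S)"
    and ideal_generated: "genideal R (commutators R) = carrier R"
begin

section \<open>Products of elements of \<open>S\<close> and their commutators\<close>

abbreviation P where "P \<equiv> n_products R n S"

abbreviation bounded where "bounded \<equiv> bounded_sums R P"

lemma S_carrier: "x \<in> S \<Longrightarrow> x \<in> carrier R"
  using S_closed by blast

lemmas products_closed = n_products_closed[OF S_closed]

lemma zero_P: "\<zero> \<in> P"
proof -
  obtain k where n: "n = Suc k" using n_gt_1 by (cases n) auto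
  have "list_mult R (replicate n \<zero>) = \<zero>"
    unfolding n using list_mult_closed[of "replicate k \<zero>"] by (simp add: set_replicate_conv_if)
  then show ?thesis using zero_S unfolding n_products_def
    by (metis (mono_tags, lifting) in_set_replicate length_replicate mem_Collect_eq subsetI)
qed

text \<open>The sign is absorbed by the first factor, which exists because
  \<open>n > 1\<close>.\<close>

lemma minus_P:
  assumes "x \<in> P" shows "\<ominus> x \<in> P"
proof -
  have "x \<in> n_products R (1 + (n - 1)) S" using assms n_gt_1 by simp
  then obtain y z where yz: "x = y \<otimes> z" "y \<in> n_products R 1 S" "z \<in> n_products R (n - 1) S"
    using n_products_split[OF S_closed] by blast
  have "y \<in> S"
  proof -
    obtain ys where "y = list_mult R ys" "length ys = 1" "set ys \<subseteq> S"
      using yz(2) unfolding n_products_def by blast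
    then show ?thesis using S_carrier by (cases ys) auto
  qed
  then have "\<ominus> y \<otimes> z \<in> n_products R (1 + (n - 1)) S"
    using n_products_mult[OF S_closed n_products_1[OF S_closed minus_S] yz(3)] by blast
  then show ?thesis
    using yz products_closed[of "n - 1"] n_gt_1 S_carrier[OF \<open>y \<in> S\<close>] by (auto simp: l_minus subset_iff)
qed

text \<open>By the Leibniz rule each of the \<open>k\<close> factors in turn is replaced by its
  commutator with \<open>r\<close>, a sum of \<open>m\<close> elements of \<open>S\<close>. The
  length of the products stays \<open>k\<close>.\<close>

lemma commutator_products:
  assumes r: "r \<in> carrier R" and x: "x \<in> n_products R k S"
  shows "commutator R x r \<in> nsums R (n_products R k S) (k * m)"
proof -
  have "commutator R (list_mult R ys) r \<in> nsums R (n_products R (length ys) S) (length ys * m)"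
    if "set ys \<subseteq> S" for ys
    using that
  proof (induction ys)
    case Nil
    then show ?case using r by (simp add: commutator_def)
  next
    case (Cons y ys)
    let ?k = "length ys" and ?u = "list_mult R ys"
    have y: "y \<in> S" "y \<in> carrier R" using Cons S_closed by auto
    have u: "?u \<in> n_products R ?k S" using Cons unfolding n_products_def by auto
    then have uR: "?u \<in> carrier R" using products_closed by blast
    \<comment> \<open>The trailing factor 1 records that left multiplication by \<open>y\<close>
      turns one product into one product.\<close>
    have "y \<otimes> commutator R ?u r \<in> nsums R (n_products R (Suc ?k) S) (?k * m * 1)"
    proof (rule nsums_image[where h = "\<lambda>v. y \<otimes> v", OF products_closed[of ?k] products_closed])
      fix v assume "v \<in> n_products R ?k S"
      then show "y \<otimes> v \<in> nsums R (n_products R (Suc ?k) S) 1"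
        using nsums_incl[OF products_closed]
          n_products_mult[OF S_closed n_products_1[OF S_closed y(1)], of v ?k] by simp
    qed (use y Cons in \<open>auto simp: r_distr\<close>)
    moreover have "commutator R y r \<otimes> ?u \<in> nsums R (n_products R (Suc ?k) S) (m * 1)"
    proof (rule nsums_image[where h = "\<lambda>v. v \<otimes> ?u", OF S_closed products_closed])
      fix v assume "v \<in> S"
      then show "v \<otimes> ?u \<in> nsums R (n_products R (Suc ?k) S) 1"
        using nsums_incl[OF products_closed]
          n_products_mult[OF S_closed n_products_1[OF S_closed] u, of v] by simp
    qed (use y uR r commutator_S in \<open>auto simp: l_distr\<close>)
    ultimately show ?case
      using nsums_add[OF products_closed] y uR r
      by (fastforce simp: commutator_mult_left ac_simps)
  qed
  then show ?thesis using x unfolding n_products_def by blast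
qed

lemma mem_nsums:
  assumes "x \<in> carrier R" obtains k where "x \<in> nsums R P k"
  using assms additive_span_eq_nsums[OF products_closed minus_P] span by auto

text \<open>Each of the \<open>N\<close> summands of an element of \<open>A\<close> contributes
  \<open>n * m\<close> products, whatever \<open>r\<close> is.\<close>

lemma bounded_commutators:
  assumes "bounded A"
  shows "bounded {commutator R x r | x r. x \<in> A \<and> r \<in> carrier R}"
proof -
  obtain N where N: "A \<subseteq> nsums R P N" using assms unfolding bounded_sums_def by blast
  have "commutator R x r \<in> nsums R P (N * (n * m))" if "x \<in> A" "r \<in> carrier R" for x r
    by (rule nsums_image[OF products_closed products_closed])
      (use that N commutator_add_left commutator_products in auto)
  then show ?thesis unfolding bounded_sums_def by blast
qed

text \<open>A single element is a sum of some number of products, so its singleton is bounded. The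
  resulting bound depends on \<open>x\<close> but is uniform in \<open>r\<close>.\<close>

lemma bounded_commutators_element:
  assumes "x \<in> carrier R"
  shows "bounded {commutator R x r | r. r \<in> carrier R}"
proof -
  obtain k where "x \<in> nsums R P k" using mem_nsums[OF assms] .
  then have "bounded {x}" unfolding bounded_sums_def by blast
  from bounded_commutators[OF this] show ?thesis by simp
qed

text \<open>Only right multiples appear here, yet the ideal turns out two-sided. The aim is to show
  that it contains 1.\<close>

definition bounding_ideal :: "'a set" where
  "bounding_ideal = {a \<in> carrier R. bounded {a \<otimes> r | r. r \<in> carrier R}}"

text \<open>Bounds add up under sums, and the right multiples of \<open>a x\<close> are among those
  of \<open>a\<close>. Absorption from the left rests on boundedness of commutators with a bounded
  set.\<close>

lemma ideal_bounding_ideal: "ideal bounding_ideal R"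
proof (rule idealI)
  note P = products_closed[of n]
  show "ring R" by (rule ring_axioms)
  show "subgroup bounding_ideal (add_monoid R)"
  proof (rule add.subgroupI)
    show "bounding_ideal \<subseteq> carrier R" unfolding bounding_ideal_def by blast
    have "{\<zero> \<otimes> r | r. r \<in> carrier R} \<subseteq> nsums R P 0" by auto
    then show "bounding_ideal \<noteq> {}" unfolding bounding_ideal_def bounded_sums_def by blast
    show "\<ominus> a \<in> bounding_ideal" if a: "a \<in> bounding_ideal" for a
    proof -
      have aR: "a \<in> carrier R" using a unfolding bounding_ideal_def by blast
      have "bounded (a_inv R ` {a \<otimes> r | r. r \<in> carrier R})"
        using a bounded_sums_minus[OF P minus_P] unfolding bounding_ideal_def by blast
      moreover have "{\<ominus> a \<otimes> r | r. r \<in> carrier R} \<subseteq> a_inv R ` {a \<otimes> r | r. r \<in> carrier R}"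
        using aR by (auto simp: l_minus)
      ultimately show ?thesis
        using aR bounded_sums_subset unfolding bounding_ideal_def by blast
    qed
    show "a \<oplus> b \<in> bounding_ideal"
      if a: "a \<in> bounding_ideal" and b: "b \<in> bounding_ideal" for a b
    proof -
      have R: "a \<in> carrier R" "b \<in> carrier R" using a b unfolding bounding_ideal_def by auto
      have "bounded {x \<oplus> y | x y. x \<in> {a \<otimes> r | r. r \<in> carrier R} \<and> y \<in> {b \<otimes> r | r. r \<in> carrier R}}"
        using a b bounded_sums_add[OF P] unfolding bounding_ideal_def by blast
      moreover have "{(a \<oplus> b) \<otimes> r | r. r \<in> carrier R} \<subseteq>
          {x \<oplus> y | x y. x \<in> {a \<otimes> r | r. r \<in> carrier R} \<and> y \<in> {b \<otimes> r | r. r \<in> carrier R}}"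
        using R l_distr by blast
      ultimately show ?thesis
        using R bounded_sums_subset unfolding bounding_ideal_def by auto
    qed
  qed
next
  fix a x assume a: "a \<in> bounding_ideal" and x: "x \<in> carrier R"
  let ?A = "{a \<otimes> r | r. r \<in> carrier R}"
  have aR: "a \<in> carrier R" and A: "bounded ?A" using a unfolding bounding_ideal_def by auto
  have "{(a \<otimes> x) \<otimes> r | r. r \<in> carrier R} \<subseteq> ?A" using aR x m_assoc by blast
  then show "a \<otimes> x \<in> bounding_ideal"
    using aR x A bounded_sums_subset unfolding bounding_ideal_def by blast
  \<comment> \<open>The decomposition is \<open>x a r = [-(a r), x] + a (r x)\<close>. The negation
    puts the bounded element in the left argument of the commutator, as
    \<open>bounded_commutators\<close> expects.\<close>
  let ?C = "{commutator R y r | y r. y \<in> a_inv R ` ?A \<and> r \<in> carrier R}"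
  have "bounded {u \<oplus> v | u v. u \<in> ?C \<and> v \<in> ?A}"
    using bounded_sums_add[OF products_closed bounded_commutators A]
      bounded_sums_minus[OF products_closed minus_P A] by blast
  moreover have "{(x \<otimes> a) \<otimes> r | r. r \<in> carrier R} \<subseteq> {u \<oplus> v | u v. u \<in> ?C \<and> v \<in> ?A}"
  proof clarify
    fix r assume r: "r \<in> carrier R"
    have "(x \<otimes> a) \<otimes> r = commutator R (\<ominus> (a \<otimes> r)) x \<oplus> a \<otimes> (r \<otimes> x)"
      unfolding commutator_def using aR x r by algebra
    moreover have "commutator R (\<ominus> (a \<otimes> r)) x \<in> ?C" using r x by blast
    moreover have "a \<otimes> (r \<otimes> x) \<in> ?A" using r x by blast
    ultimately show "\<exists>u v. (x \<otimes> a) \<otimes> r = u \<oplus> v \<and> u \<in> ?C \<and> v \<in> ?A" by blast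
  qed
  ultimately show "x \<otimes> a \<in> bounding_ideal"
    using aR x bounded_sums_subset unfolding bounding_ideal_def by blast
qed

text \<open>In \<open>[a, y] r = a [y, r] - [y, a r]\<close> the first term is a sum of
  \<open>m\<close> products of exactly \<open>n\<close> elements, since \<open>a\<close> has
  \<open>n - 1\<close> factors and \<open>[y, r]\<close> is a sum of \<open>m\<close> elements of
  \<open>S\<close>. The second is bounded because \<open>y\<close> is fixed.\<close>

lemma commutator_bounding_ideal:
  assumes a: "a \<in> n_products R (n - 1) S" and y: "y \<in> S"
  shows "commutator R a y \<in> bounding_ideal"
proof -
  have R: "a \<in> carrier R" "y \<in> carrier R" using a y products_closed S_closed by blast+
  let ?A = "{a \<otimes> commutator R y r | r. r \<in> carrier R}"
  let ?B = "{commutator R y r | r. r \<in> carrier R}"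
  have "a \<otimes> commutator R y r \<in> nsums R P (m * 1)" if r: "r \<in> carrier R" for r
  proof (rule nsums_image[where h = "\<lambda>v. a \<otimes> v", OF S_closed products_closed])
    fix v assume "v \<in> S"
    then show "a \<otimes> v \<in> nsums R P 1"
      using nsums_incl[OF products_closed] n_gt_1
        n_products_mult[OF S_closed a n_products_1[OF S_closed], of v] by simp
  qed (use R r y commutator_S in \<open>auto simp: r_distr\<close>)
  then have "bounded ?A" unfolding bounded_sums_def by blast
  moreover have "bounded (a_inv R ` ?B)"
    using bounded_sums_minus[OF products_closed minus_P bounded_commutators_element[OF R(2)]] .
  ultimately have "bounded {u \<oplus> v | u v. u \<in> ?A \<and> v \<in> a_inv R ` ?B}"
    by (rule bounded_sums_add[OF products_closed])
  moreover have "{commutator R a y \<otimes> r | r. r \<in> carrier R} \<subseteq>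
      {u \<oplus> v | u v. u \<in> ?A \<and> v \<in> a_inv R ` ?B}"
  proof clarify
    fix r assume r: "r \<in> carrier R"
    have "commutator R a y \<otimes> r = a \<otimes> commutator R y r \<oplus> \<ominus> commutator R y (a \<otimes> r)"
      unfolding commutator_def using R r by algebra
    moreover have "\<ominus> commutator R y (a \<otimes> r) \<in> a_inv R ` ?B" using R r by blast
    ultimately show "\<exists>u v. commutator R a y \<otimes> r = u \<oplus> v \<and> u \<in> ?A \<and> v \<in> a_inv R ` ?B"
      using r by blast
  qed
  ultimately show ?thesis
    using R bounded_sums_subset unfolding bounding_ideal_def by auto
qed

section \<open>Multiplicatively closed subgroups containing all products of one length\<close>

lemma products_in_subring:
  assumes T: "subgroup T (add_monoid R)" and mult: "\<And>x y. x \<in> T \<Longrightarrow> y \<in> T \<Longrightarrow> x \<otimes> y \<in> T"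
    and sub: "n_products R k S \<subseteq> T"
  shows "n_products R (Suc j * k) S \<subseteq> T"
proof (induction j)
  case (Suc j)
  show ?case
  proof
    fix x assume "x \<in> n_products R (Suc (Suc j) * k) S"
    then have "x \<in> n_products R (k + Suc j * k) S" by simp
    then obtain y z where "x = y \<otimes> z" "y \<in> n_products R k S" "z \<in> n_products R (Suc j * k) S"
      using n_products_split[OF S_closed] by blast
    then show "x \<in> T" using mult sub Suc by blast
  qed
qed (use sub in simp)

text \<open>A product of \<open>Suc k * n\<close> elements can be cut into \<open>n\<close> blocks
  of length \<open>Suc k\<close>, which places it in \<open>T\<close>, and such products generate
  the ring additively.\<close>

lemma subring_eq_carrier:
  assumes T: "subgroup T (add_monoid R)" and mult: "\<And>x y. x \<in> T \<Longrightarrow> y \<in> T \<Longrightarrow> x \<otimes> y \<in> T"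
    and sub: "n_products R (Suc k) S \<subseteq> T"
  shows "T = carrier R"
proof (rule subgroup_generated_by_n_products_mult[OF S_closed span T])
  obtain l where n: "n = Suc l" using n_gt_1 by (cases n) auto
  show "n_products R (Suc k * n) S \<subseteq> T"
    using products_in_subring[OF T mult sub, of l] by (simp only: n mult.commute)
qed

lemma commutators_bounding_ideal:
  assumes "x \<in> carrier R" "y \<in> carrier R"
  shows "commutator R x y \<in> bounding_ideal"
proof -
  note comm = subring_commuting_mod_ideal[OF ideal_bounding_ideal]
  interpret I: ideal bounding_ideal R by (rule ideal_bounding_ideal)
  let ?T = "\<lambda>B. {x \<in> carrier R. \<forall>b\<in>B. commutator R x b \<in> bounding_ideal}"
  have swap: "commutator R b a \<in> bounding_ideal"
    if "commutator R a b \<in> bounding_ideal" "a \<in> carrier R" "b \<in> carrier R" for a b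
    using that by (simp add: commutator_swap[of a b])
  \<comment> \<open>First centralizer: it contains \<open>S\<close> by
    \<open>commutator_bounding_ideal\<close>, hence is everything. So products of
    \<open>n - 1\<close> elements are central modulo the ideal.\<close>
  have S: "?T (n_products R (n - 1) S) = carrier R"
  proof (rule subring_eq_carrier[where k = 0])
    show "n_products R (Suc 0) S \<subseteq> ?T (n_products R (n - 1) S)"
    proof
      fix y assume "y \<in> n_products R (Suc 0) S"
      then obtain ys where "y = list_mult R ys" "length ys = 1" "set ys \<subseteq> S"
        unfolding n_products_def by auto
      then have "y \<in> S" using S_carrier by (cases ys) auto
      then show "y \<in> ?T (n_products R (n - 1) S)"
        using commutator_bounding_ideal swap products_closed S_carrier by blast
    qed
  qed (use comm[OF products_closed] in blast)+
  \<comment> \<open>Second centralizer, the center modulo the ideal: it contains the products of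
    \<open>n - 1 = Suc (n - 2)\<close> elements, which have at least one factor because
    \<open>n > 1\<close>.\<close>
  have "?T (carrier R) = carrier R"
  proof (rule subring_eq_carrier[where k = "n - 2"])
    have "n_products R (n - 1) S \<subseteq> ?T (carrier R)"
      using S swap products_closed[of "n - 1"] by blast
    moreover have "n - 1 = Suc (n - 2)" using n_gt_1 by simp
    ultimately show "n_products R (Suc (n - 2)) S \<subseteq> ?T (carrier R)" by simp
  qed (use comm[OF subset_refl] in blast)+
  then show ?thesis using assms by blast
qed

theorem bounded_carrier: "bounded (carrier R)"
proof -
  have "commutators R \<subseteq> bounding_ideal"
    using commutators_bounding_ideal unfolding commutators_def commutator_def by blast
  then have "carrier R \<subseteq> bounding_ideal"
    using genideal_minimal[OF ideal_bounding_ideal] ideal_generated by blast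
  then have "bounded {\<one> \<otimes> r | r. r \<in> carrier R}" unfolding bounding_ideal_def by blast
  then show ?thesis by (rule bounded_sums_subset) force
qed

end

subsection \<open>Values of a multilinear polynomial\<close>

lemma (in abelian_monoid) finsum_swap:
  assumes "finite A" "finite B" "\<And>i j. i \<in> A \<Longrightarrow> j \<in> B \<Longrightarrow> g i j \<in> carrier G"
  shows "(\<Oplus>i\<in>A. \<Oplus>j\<in>B. g i j) = (\<Oplus>j\<in>B. \<Oplus>i\<in>A. g i j)"
  using assms(1,3)
proof (induction A rule: finite_induct)
  case empty
  then show ?case by (simp add: finsum_zero)
next
  case (insert a A)
  have "(\<Oplus>j\<in>B. \<Oplus>i\<in>insert a A. g i j) = (\<Oplus>j\<in>B. g a j \<oplus> (\<Oplus>i\<in>A. g i j))"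
    by (rule finsum_cong') (use insert in \<open>auto simp: Pi_iff finsum_insert intro!: finsum_closed\<close>)
  also have "\<dots> = (\<Oplus>j\<in>B. g a j) \<oplus> (\<Oplus>j\<in>B. \<Oplus>i\<in>A. g i j)"
    by (rule finsum_addf) (use insert in \<open>auto simp: Pi_iff intro!: finsum_closed\<close>)
  also have "\<dots> = (\<Oplus>i\<in>insert a A. \<Oplus>j\<in>B. g i j)"
    using insert by (subst finsum_insert) (auto simp: Pi_iff intro!: finsum_closed)
  finally show ?case by simp
qed

lemma (in ring) finsum_image:
  assumes "finite A" "g \<in> A \<rightarrow> carrier R"
    and "h \<in> carrier R \<rightarrow> carrier R" "h \<zero> = \<zero>"
    and "\<And>x y. x \<in> carrier R \<Longrightarrow> y \<in> carrier R \<Longrightarrow> h (x \<oplus> y) = h x \<oplus> h y"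
  shows "h (\<Oplus>i\<in>A. g i) = (\<Oplus>i\<in>A. h (g i))"
  using assms(1,2)
proof (induction A rule: finite_induct)
  case (insert a A)
  then have "h (finsum R g (insert a A)) = h (g a \<oplus> finsum R g A)" by (simp add: Pi_iff)
  also have "\<dots> = h (g a) \<oplus> (\<Oplus>i\<in>A. h (g i))"
    using insert assms(5) by (simp add: Pi_iff)
  also have "\<dots> = (\<Oplus>i\<in>insert a A. h (g i))"
    using insert assms(3) by (subst finsum_insert) (auto simp: Pi_iff)
  finally show ?case .
qed (use assms in simp)

section \<open>Monomials when one variable is changed\<close>

lemma (in ring) list_mult_map_closed:
  "a \<in> UNIV \<rightarrow> carrier R \<Longrightarrow> list_mult R (map a w) \<in> carrier R"
  by (induction w) (auto simp: Pi_iff)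

text \<open>In a distinct word the variable \<open>i\<close> occurs exactly once, so exactly one
  sign comes out.\<close>

lemma (in ring) list_mult_minus_upd:
  assumes "a \<in> UNIV \<rightarrow> carrier R" "distinct w" "i \<in> set w"
  shows "list_mult R (map (a(i := \<ominus> a i)) w) = \<ominus> list_mult R (map a w)"
  using assms(2,3)
proof (induction w)
  case (Cons j w)
  have cl: "list_mult R (map a w) \<in> carrier R" "a j \<in> carrier R"
    using assms(1) list_mult_map_closed by auto
  show ?case
  proof (cases "j = i")
    case True
    then have "map (a(i := \<ominus> a i)) w = map a w" using Cons by auto
    then have "list_mult R (map (a(i := \<ominus> a i)) (j # w)) = \<ominus> a j \<otimes> list_mult R (map a w)"
      using True by (simp only: list.map list_mult_simps fun_upd_same)
    then show ?thesis using cl by (simp only: list.map list_mult_simps l_minus)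
  next
    case False
    then show ?thesis using Cons cl by (simp add: r_minus)
  qed
qed simp

text \<open>This is the iterated Leibniz rule. Distinctness allows summation over variables instead
  of positions, since changing the value of one variable changes just one factor.\<close>

lemma (in ring) commutator_list_mult:
  assumes a: "a \<in> UNIV \<rightarrow> carrier R" and "distinct w" and r: "r \<in> carrier R"
  shows "commutator R (list_mult R (map a w)) r =
    (\<Oplus>i\<in>set w. list_mult R (map (a(i := commutator R (a i) r)) w))"
  using assms(2)
proof (induction w)
  case Nil
  then show ?case using r by (simp add: commutator_def)
next
  case (Cons j w)
  let ?b = "\<lambda>i. a(i := commutator R (a i) r)"
  have b: "list_mult R (map (?b i) v) \<in> carrier R" for i v
    using a r by (intro list_mult_map_closed) (auto simp: Pi_iff)
  have cl: "list_mult R (map a w) \<in> carrier R" "a j \<in> carrier R"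
    using a list_mult_map_closed by auto
  \<comment> \<open>The head \<open>j\<close> does not recur in \<open>w\<close>, so changing its
    value leaves the tail alone.\<close>
  have j: "map (?b j) w = map a w" using Cons by auto
  have "(\<Oplus>i\<in>set w. list_mult R (map (?b i) (j # w))) =
      (\<Oplus>i\<in>set w. a j \<otimes> list_mult R (map (?b i) w))"
    by (rule finsum_cong') (use Cons b cl in \<open>auto simp: Pi_iff\<close>)
  also have "\<dots> = a j \<otimes> commutator R (list_mult R (map a w)) r"
    using Cons b cl by (simp add: finsum_rdistr del: fun_upd_apply)
  finally have w: "(\<Oplus>i\<in>set w. list_mult R (map (?b i) (j # w))) =
      a j \<otimes> commutator R (list_mult R (map a w)) r" .
  have "list_mult R (map (?b j) (j # w)) = commutator R (a j) r \<otimes> list_mult R (map a w)"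
    by (simp only: list.map list_mult_simps fun_upd_same j)
  moreover have "(\<Oplus>i\<in>set (j # w). list_mult R (map (?b i) (j # w))) =
      list_mult R (map (?b j) (j # w)) \<oplus> (\<Oplus>i\<in>set w. list_mult R (map (?b i) (j # w)))"
    unfolding list.set by (rule finsum_insert) (use Cons b in \<open>auto simp del: list.map\<close>)
  ultimately show ?case
    unfolding w using cl r by (simp add: commutator_mult_left a_comm del: map_fun_upd fun_upd_apply)
qed

text \<open>Outside the words \<open>map \<sigma> [1..<Suc m]\<close> every term of the defining sum
  vanishes. From here on multilinearity is used only as this condition on the support; the
  coefficients stay arbitrary.\<close>

lemma multilinear_support:
  assumes "cring K" "multilinear K f"
  obtains m where "m \<ge> 1" "\<And>w. f w \<noteq> \<zero>\<^bsub>K\<^esub> \<Longrightarrow> distinct w \<and> set w = {1..m}"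
proof -
  interpret cring K by fact
  obtain m c where m: "m \<ge> 1" and c: "c \<in> {\<sigma>. \<sigma> permutes {1..m}} \<rightarrow> carrier K"
    and f: "f = (\<lambda>v. \<Oplus>\<^bsub>K\<^esub>\<sigma>\<in>{\<sigma>. \<sigma> permutes {1..m}}.
                    c \<sigma> \<otimes>\<^bsub>K\<^esub> word_monomial K (map \<sigma> [1..<Suc m]) v)"
    using assms(2) unfolding multilinear_def by blast
  have "distinct w \<and> set w = {1..m}" if w: "f w \<noteq> \<zero>\<^bsub>K\<^esub>" for w
  proof -
    have "\<exists>\<sigma>. \<sigma> permutes {1..m} \<and> w = map \<sigma> [1..<Suc m]"
    proof (rule ccontr)
      assume "\<nexists>\<sigma>. \<sigma> permutes {1..m} \<and> w = map \<sigma> [1..<Suc m]"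
      then have "f w = \<zero>\<^bsub>K\<^esub>"
        unfolding f using c
        by (intro add.finprod_one_eqI) (auto simp: word_monomial_def Pi_iff simp del: upt_Suc)
      then show False using w by contradiction
    qed
    then obtain \<sigma> where \<sigma>: "\<sigma> permutes {1..m}" "w = map \<sigma> [1..<Suc m]" by blast
    have "set [1..<Suc m] = {1..m}" by auto
    then show ?thesis
      using \<sigma> permutes_image[OF \<sigma>(1)] permutes_inj_on[OF \<sigma>(1)]
      by (auto simp: distinct_map simp del: upt_Suc)
  qed
  then show thesis using that m by blast
qed

locale multilinear_values = assoc_algebra K R
  for K :: "('k, 'm) ring_scheme" (structure) and R :: "('k, 'r, 'n) module_scheme" (structure) +
  fixes f :: "nat list \<Rightarrow> 'k" and m :: nat
  assumes f: "f \<in> free_algebra_elements K"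
    and m: "m \<ge> 1"
    and support: "f w \<noteq> \<zero>\<^bsub>K\<^esub> \<Longrightarrow> distinct w \<and> set w = {1..m}"
begin

section \<open>The value set meets the requirements of \<open>spanning_products\<close>\<close>

lemma finite_support: "finite {w. f w \<noteq> \<zero>\<^bsub>K\<^esub>}"
  and coeff_closed: "f w \<in> carrier K"
  using f unfolding free_algebra_elements_def by auto

lemma monomial_closed:
  "a \<in> UNIV \<rightarrow> carrier R \<Longrightarrow> f w \<odot>\<^bsub>R\<^esub> list_mult R (map a w) \<in> carrier R"
  by (auto intro!: smult_closed list_mult_map_closed coeff_closed)

lemma eval_closed: "a \<in> UNIV \<rightarrow> carrier R \<Longrightarrow> eval_nc K R f a \<in> carrier R"
  unfolding eval_nc_def by (auto intro!: M.finsum_closed monomial_closed)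

lemma image_closed: "image_nc K R f \<subseteq> carrier R"
  unfolding image_nc_def using eval_closed by blast

lemma zero_image: "\<zero>\<^bsub>R\<^esub> \<in> image_nc K R f"
proof -
  have "f w \<odot>\<^bsub>R\<^esub> list_mult R (map (\<lambda>_. \<zero>\<^bsub>R\<^esub>) w) = \<zero>\<^bsub>R\<^esub>" if "f w \<noteq> \<zero>\<^bsub>K\<^esub>" for w
  proof -
    have "set w = {1..m}" using support[OF that] by blast
    \<comment> \<open>Since \<open>m \<ge> 1\<close>, no word of the support is empty: there is no
      constant term, and a zero factor kills each monomial.\<close>
    then obtain i v where w: "w = i # v" using m by (cases w) auto
    have "list_mult R (map (\<lambda>_. \<zero>\<^bsub>R\<^esub>) v) \<in> carrier R" by (auto intro!: list_mult_map_closed)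
    then show ?thesis using w coeff_closed by simp
  qed
  then have "eval_nc K R f (\<lambda>_. \<zero>\<^bsub>R\<^esub>) = \<zero>\<^bsub>R\<^esub>"
    unfolding eval_nc_def by (intro M.add.finprod_one_eqI[simplified]) auto
  then show ?thesis unfolding image_nc_def by force
qed

lemma minus_image:
  assumes "x \<in> image_nc K R f" shows "\<ominus>\<^bsub>R\<^esub> x \<in> image_nc K R f"
proof -
  obtain a where a: "a \<in> UNIV \<rightarrow> carrier R" "x = eval_nc K R f a"
    using assms unfolding image_nc_def by blast
  \<comment> \<open>Variable 1 occurs exactly once in every word of the support, so negating its
    value negates the value of \<open>f\<close>.\<close>
  let ?b = "a(1 := \<ominus>\<^bsub>R\<^esub> a 1)"
  have b: "?b \<in> UNIV \<rightarrow> carrier R" using a(1) by (auto simp: Pi_iff)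
  have "\<ominus>\<^bsub>R\<^esub> x = (\<Oplus>\<^bsub>R\<^esub>w\<in>{w. f w \<noteq> \<zero>\<^bsub>K\<^esub>}. \<ominus>\<^bsub>R\<^esub> (f w \<odot>\<^bsub>R\<^esub> list_mult R (map a w)))"
    unfolding a(2) eval_nc_def
    by (rule finsum_image)
      (use finite_support monomial_closed[OF a(1)] in \<open>auto simp: minus_add a_comm\<close>)
  also have "\<dots> = eval_nc K R f ?b"
    unfolding eval_nc_def
  proof (rule M.finsum_cong')
    show "(\<lambda>w. f w \<odot>\<^bsub>R\<^esub> list_mult R (map ?b w)) \<in> {w. f w \<noteq> \<zero>\<^bsub>K\<^esub>} \<rightarrow> carrier R"
      using monomial_closed[OF b] by blast
  next
    fix w assume "w \<in> {w. f w \<noteq> \<zero>\<^bsub>K\<^esub>}"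
    then have "distinct w" "1 \<in> set w" using support m by auto
    then show "\<ominus>\<^bsub>R\<^esub> (f w \<odot>\<^bsub>R\<^esub> list_mult R (map a w)) = f w \<odot>\<^bsub>R\<^esub> list_mult R (map ?b w)"
      using a(1) coeff_closed list_mult_minus_upd[OF a(1)]
      by (simp only:) (rule smult_r_minus[symmetric], auto intro!: list_mult_map_closed)
  qed simp
  finally show ?thesis using b unfolding image_nc_def by blast
qed

text \<open>Commutation with \<open>r\<close> acts on every monomial by the Leibniz rule, and all
  words of the support share the variables \<open>{1..m}\<close>. Collecting the terms by variable
  therefore gives \<open>m\<close> values of \<open>f\<close>.\<close>

lemma commutator_image:
  assumes "x \<in> image_nc K R f" and r: "r \<in> carrier R"
  shows "commutator R x r \<in> nsums R (image_nc K R f) m"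
proof -
  obtain a where a: "a \<in> UNIV \<rightarrow> carrier R" "x = eval_nc K R f a"
    using assms unfolding image_nc_def by blast
  let ?W = "{w. f w \<noteq> \<zero>\<^bsub>K\<^esub>}"
  let ?b = "\<lambda>i. a(i := commutator R (a i) r)"
  have aR: "a i \<in> carrier R" for i using a(1) by auto
  have b: "?b i \<in> UNIV \<rightarrow> carrier R" for i using aR r by auto
  have lm: "list_mult R (map c w) \<in> carrier R" if "c \<in> UNIV \<rightarrow> carrier R" for c w
    using that by (rule list_mult_map_closed)
  have smult_commutator: "commutator R (f w \<odot>\<^bsub>R\<^esub> p) r = f w \<odot>\<^bsub>R\<^esub> commutator R p r"
    if "p \<in> carrier R" for w p
    unfolding commutator_def a_minus_def
    using that r coeff_closed[of w]
    by (simp add: smult_mult_left smult_mult_right smult_r_distr smult_r_minus)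
  have "commutator R x r = (\<Oplus>\<^bsub>R\<^esub>w\<in>?W. commutator R (f w \<odot>\<^bsub>R\<^esub> list_mult R (map a w)) r)"
    unfolding a(2) eval_nc_def
    by (rule finsum_image[where h = "\<lambda>y. commutator R y r"])
      (use finite_support monomial_closed[OF a(1)] r in \<open>auto simp: commutator_add_left\<close>)
  also have "\<dots> = (\<Oplus>\<^bsub>R\<^esub>w\<in>?W. \<Oplus>\<^bsub>R\<^esub>i\<in>{1..m}. f w \<odot>\<^bsub>R\<^esub> list_mult R (map (?b i) w))"
  proof (rule M.finsum_cong')
    show "(\<lambda>w. \<Oplus>\<^bsub>R\<^esub>i\<in>{1..m}. f w \<odot>\<^bsub>R\<^esub> list_mult R (map (?b i) w)) \<in> ?W \<rightarrow> carrier R"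
      using monomial_closed[OF b] by (intro Pi_I M.finsum_closed) blast
  next
    fix w assume "w \<in> ?W"
    then have w: "distinct w" "set w = {1..m}" using support by auto
    have "commutator R (f w \<odot>\<^bsub>R\<^esub> list_mult R (map a w)) r =
        f w \<odot>\<^bsub>R\<^esub> (\<Oplus>\<^bsub>R\<^esub>i\<in>{1..m}. list_mult R (map (?b i) w))"
      using smult_commutator[OF lm[OF a(1)]] commutator_list_mult[OF a(1) w(1) r] w(2) by simp
    also have "\<dots> = (\<Oplus>\<^bsub>R\<^esub>i\<in>{1..m}. f w \<odot>\<^bsub>R\<^esub> list_mult R (map (?b i) w))"
      by (rule finsum_image)
        (use lm[OF b] coeff_closed[of w] in \<open>auto simp: smult_r_distr\<close>)
    finally show "commutator R (f w \<odot>\<^bsub>R\<^esub> list_mult R (map a w)) r =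
        (\<Oplus>\<^bsub>R\<^esub>i\<in>{1..m}. f w \<odot>\<^bsub>R\<^esub> list_mult R (map (?b i) w))" .
  qed simp
  \<comment> \<open>After the sums are interchanged, the inner sum over words for fixed
    \<open>i\<close> is the value of \<open>f\<close> at \<open>?b i\<close>.\<close>
  also have "\<dots> = (\<Oplus>\<^bsub>R\<^esub>i\<in>{1..m}. eval_nc K R f (?b i))"
    unfolding eval_nc_def
    by (rule M.finsum_swap) (use finite_support monomial_closed[OF b] in auto)
  finally show ?thesis
    using b unfolding nsums_eq_finsum[OF image_closed] by (auto simp: image_nc_def)
qed

end

theorem theorem8:
  fixes K :: "('k, 'm) ring_scheme"
    and R :: "('k, 'r, 'n) module_scheme"
    and f :: "nat list \<Rightarrow> 'k"
    and n :: nat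
  assumes "assoc_algebra K R"
    and "f \<in> free_algebra_elements K"
    and "multilinear K f"
    and "genideal R (commutators R) = carrier R"
    and "n > 1"
    and "carrier R = additive_span R (n_products R n (image_nc K R f))"
  shows "\<exists>N::nat. N \<ge> 1 \<and>
    (\<forall>x \<in> carrier R. \<exists>a \<in> {1..N} \<rightarrow> n_products R n (image_nc K R f).
       x = (\<Oplus>\<^bsub>R\<^esub>i\<in>{1..N}. a i))"
proof -
  interpret assoc_algebra K R by fact
  obtain m where m: "m \<ge> 1" "\<And>w. f w \<noteq> \<zero>\<^bsub>K\<^esub> \<Longrightarrow> distinct w \<and> set w = {1..m}"
    using multilinear_support[OF R.cring_axioms assms(3)] by blast
  interpret multilinear_values K R f m
    by unfold_locales (use assms(2) m in auto)
  interpret S: spanning_products R "image_nc K R f" m n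
    by unfold_locales
      (use assms(4-6) image_closed zero_image minus_image commutator_image in auto)
  obtain N where "carrier R \<subseteq> nsums R S.P N"
    using S.bounded_carrier unfolding bounded_sums_def by blast
  \<comment> \<open>One zero summand is added so that the number of summands is at least 1.\<close>
  also have "nsums R S.P N \<subseteq> nsums R S.P (Suc N)"
    using nsums_subset_Suc[OF S.products_closed S.zero_P] .
  finally have "carrier R \<subseteq> nsums R S.P (Suc N)" .
  then have "\<exists>a \<in> {1..Suc N} \<rightarrow> S.P. x = (\<Oplus>\<^bsub>R\<^esub>i\<in>{1..Suc N}. a i)" if "x \<in> carrier R" for x
    unfolding nsums_eq_finsum[OF S.products_closed] using that by blast
  moreover have "Suc N \<ge> 1" by simp
  ultimately show ?thesis by meson
qed

end
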